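(* Let $n\ge1$ and fix contexts $\mathbf{x}$. Every counting policy is a non-decreasing separable policy.
   Context: Let $\mathcal{Y}=[0,1]$ and let $\Delta(\mathcal{Y})$ be the set of probability distributions on $\mathcal{Y}$; an element $F\in\Delta(\mathcal{Y})$ is identified with its cumulative distribution function. Let $\mathcal{X}$ be a set of contexts and $\mathbf{x}=(x_0,\dots,x_n)\in\mathcal{X}^{n+1}$ fixed. A (deterministic) data-driven policy $\pi$ maps $(\mathbf{x},\mathbf{y})$ with $\mathbf{y}=(y_1,\dots,y_n)\in\mathcal{Y}^n$ to an action $\pi(\mathbf{x},\mathbf{y})\in\mathcal{Y}$. Counting policy: a deterministic policy $\pi$ is a counting policy if there is a function $\kappa^\pi:\{0,1\}^n\to\{0,1\}$ (possibly depending on the fixed $\mathbf{x}$) such that for every $y\in[0,1]$ and every $\mathbf{y}\in\mathcal{Y}^n$, $$\mathbf{1}\{\pi(\mathbf{x},\mathbf{y})\le y\}=\kappa^\pi(\mathbf{1}\{y_1\le y\},\dots,\mathbf{1}\{y_n\le y\}).$$ Separable policy: a policy $\pi$ is separable if there is a function $P^\pi:[0,1]^n\to[0,1]$ (possibly depending on the fixed $\mathbf{x}$) such that for all $F_1,\dots,F_n\in\Delta(\mathcal{Y})$ and all $y\in\mathcal{Y}=[0,1]$, $$\mathbb{P}_{\mathbf{y}\sim F_1\times\cdots\times F_n}(\pi(\mathbf{x},\mathbf{y})\le y)=P^\pi(F_1(y),\dots,F_n(y)).$$ It is non-decreasing separable if such a $P^\pi$ can be chosen non-decreasing in each coordinate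 (the other coordinates being fixed in $[0,1]$). *)

theory Defs
  imports "HOL-Probability.Probability"
begin

abbreviation \<Y> :: "real set" where
  "\<Y> \<equiv> {0..1}"

abbreviation borel_\<Y> :: "real measure" where
  "borel_\<Y> \<equiv> restrict_space borel \<Y>"

definition distributions_on_\<Y> :: "real measure set" where
  "distributions_on_\<Y> = {M. prob_space M \<and> sets M = sets borel_\<Y>}"

text \<open>The library constant \<open>cdf\<close> measures the set \<open>{..y}\<close>, which is not measurable in a
  measure whose space is \<open>\<Y>\<close>; hence the restriction to the space here.\<close>

definition cdf_on_\<Y> :: "real measure \<Rightarrow> real \<Rightarrow> real" where
  "cdf_on_\<Y> M y = measure M {t \<in> space M. t \<le> y}"

text \<open>Contexts are indexed by \<open>0, \<dots>, n\<close>, observations by \<open>1, \<dots>, n\<close>. Tuples are extensional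
  functions on their index set.\<close>

definition policy ::
  "'c set \<Rightarrow> nat \<Rightarrow> ((nat \<Rightarrow> 'c) \<Rightarrow> (nat \<Rightarrow> real) \<Rightarrow> real) \<Rightarrow> bool" where
  "policy X n \<pi> \<longleftrightarrow>
     (\<forall>x \<in> {0..n} \<rightarrow>\<^sub>E X. \<forall>ys \<in> {1..n} \<rightarrow>\<^sub>E \<Y>. \<pi> x ys \<in> \<Y>)"

definition counting_policy ::
  "nat \<Rightarrow> (nat \<Rightarrow> 'c) \<Rightarrow> ((nat \<Rightarrow> 'c) \<Rightarrow> (nat \<Rightarrow> real) \<Rightarrow> real) \<Rightarrow> bool" where
  "counting_policy n x \<pi> \<longleftrightarrow>
     (\<exists>\<kappa> :: (nat \<Rightarrow> nat) \<Rightarrow> nat.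
        \<kappa> \<in> ({1..n} \<rightarrow>\<^sub>E {0, 1}) \<rightarrow> {0, 1} \<and>
        (\<forall>y \<in> \<Y>. \<forall>ys \<in> {1..n} \<rightarrow>\<^sub>E \<Y>.
           of_bool (\<pi> x ys \<le> y) = \<kappa> (\<lambda>i\<in>{1..n}. of_bool (ys i \<le> y))))"

text \<open>The measurability conjunct makes the probability of the event \<open>\<pi> x ys \<le> y\<close> meaningful:
  the library's \<open>measure\<close> is \<open>0\<close> on non-measurable sets.\<close>

definition separable_via ::
  "nat \<Rightarrow> (nat \<Rightarrow> 'c) \<Rightarrow> ((nat \<Rightarrow> 'c) \<Rightarrow> (nat \<Rightarrow> real) \<Rightarrow> real) \<Rightarrow> ((nat \<Rightarrow> real) \<Rightarrow> real) \<Rightarrow> bool" where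
  "separable_via n x \<pi> P \<longleftrightarrow>
     P \<in> ({1..n} \<rightarrow>\<^sub>E {0..1}) \<rightarrow> {0..1} \<and>
     \<pi> x \<in> Pi\<^sub>M {1..n} (\<lambda>_. borel_\<Y>) \<rightarrow>\<^sub>M borel_\<Y> \<and>
     (\<forall>F \<in> {1..n} \<rightarrow> distributions_on_\<Y>. \<forall>y \<in> \<Y>.
        measure (Pi\<^sub>M {1..n} F) {ys \<in> space (Pi\<^sub>M {1..n} F). \<pi> x ys \<le> y}
          = P (\<lambda>i\<in>{1..n}. cdf_on_\<Y> (F i) y))"

definition separable_policy ::
  "nat \<Rightarrow> (nat \<Rightarrow> 'c) \<Rightarrow> ((nat \<Rightarrow> 'c) \<Rightarrow> (nat \<Rightarrow> real) \<Rightarrow> real) \<Rightarrow> bool" where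
  "separable_policy n x \<pi> \<longleftrightarrow> (\<exists>P. separable_via n x \<pi> P)"

definition coordinatewise_nondecreasing :: "nat \<Rightarrow> ((nat \<Rightarrow> real) \<Rightarrow> real) \<Rightarrow> bool" where
  "coordinatewise_nondecreasing n P \<longleftrightarrow>
     (\<forall>p \<in> {1..n} \<rightarrow>\<^sub>E {0..1}. \<forall>i \<in> {1..n}. mono_on {0..1} (\<lambda>t. P (p(i := t))))"

definition nondecreasing_separable_policy ::
  "nat \<Rightarrow> (nat \<Rightarrow> 'c) \<Rightarrow> ((nat \<Rightarrow> 'c) \<Rightarrow> (nat \<Rightarrow> real) \<Rightarrow> real) \<Rightarrow> bool" where
  "nondecreasing_separable_policy n x \<pi> \<longleftrightarrow>
     (\<exists>P. separable_via n x \<pi> P \<and> coordinatewise_nondecreasing n P)"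

end

theory Submission
  imports Defs
begin

text \<open>Realising every \<open>F\<^sub>i(y)\<close> by a threshold on an independent uniform variable couples all the
  Bernoulli vectors with success probabilities \<open>p\<close>, so take \<open>P p\<close> to be the probability that
  \<open>\<kappa>\<close> accepts the vector with entries \<open>1{U\<^sub>i \<le> p\<^sub>i}\<close>. Monotonicity of \<open>P\<close> then reduces to that of
  \<open>\<kappa>\<close>, which holds because any pair of comparable 0-1 vectors arises from a single
  observation vector at two thresholds.\<close>

lemma in_pattern_cell_iff:
  assumes "C \<subseteq> I"
  shows "w \<in> (\<Pi>\<^sub>E i\<in>I. {t \<in> space (M i). t \<in> A i \<longleftrightarrow> i \<in> C}) \<longleftrightarrow>
    w \<in> space (Pi\<^sub>M I M) \<and> {i \<in> I. w i \<in> A i} = C"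
  using assms by (auto simp: space_PiM PiE_iff)

text \<open>Each point \<open>w\<close> of the product space lies in exactly one box, the one
  indexed by its pattern \<open>{i \<in> I. w i \<in> A i}\<close>. An event given by any predicate
  \<open>Q\<close> of the pattern is thus a union of boxes, a finite one when \<open>I\<close> is
  finite.\<close>

lemma pattern_event_eq:
  "{w \<in> space (Pi\<^sub>M I M). Q {i \<in> I. w i \<in> A i}} =
    (\<Union>C \<in> {C \<in> Pow I. Q C}. \<Pi>\<^sub>E i\<in>I. {t \<in> space (M i). t \<in> A i \<longleftrightarrow> i \<in> C})"
  (is "?E = ?U")
proof (rule set_eqI)
  fix w
  have "w \<in> ?U \<longleftrightarrow> (\<exists>C. C \<subseteq> I \<and> Q C \<and> w \<in> space (Pi\<^sub>M I M) \<and> {i \<in> I. w i \<in> A i} = C)"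
    using in_pattern_cell_iff[where w = w and I = I and M = M and A = A] by blast
  also have "\<dots> \<longleftrightarrow> w \<in> ?E" by auto
  finally show "w \<in> ?E \<longleftrightarrow> w \<in> ?U" by simp
qed

lemma pattern_cell_in_sets:
  assumes "A \<in> sets M"
  shows "{t \<in> space M. t \<in> A \<longleftrightarrow> b} \<in> sets M"
  using assms by measurable

lemma pattern_event_in_sets:
  assumes "finite I" and "\<And>i. i \<in> I \<Longrightarrow> A i \<in> sets (M i)"
  shows "{w \<in> space (Pi\<^sub>M I M). Q {i \<in> I. w i \<in> A i}} \<in> sets (Pi\<^sub>M I M)"
  unfolding pattern_event_eq
  using assms by (intro sets.finite_UN sets_PiM_I_finite pattern_cell_in_sets) auto

text \<open>The boxes are disjoint and each has product measure. The resulting sum sees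
  \<open>M\<close> and \<open>A\<close> only through the numbers \<open>measure (M i) (A i)\<close>,
  so product spaces with equal marginal probabilities can be exchanged for one another.\<close>

lemma measure_pattern_event:
  assumes fin: "finite I" and prob: "\<And>i. i \<in> I \<Longrightarrow> prob_space (M i)"
    and A: "\<And>i. i \<in> I \<Longrightarrow> A i \<in> sets (M i)"
  shows "measure (Pi\<^sub>M I M) {w \<in> space (Pi\<^sub>M I M). Q {i \<in> I. w i \<in> A i}} =
    (\<Sum>C | C \<subseteq> I \<and> Q C. \<Prod>i\<in>I.
      if i \<in> C then measure (M i) (A i) else 1 - measure (M i) (A i))"
proof -
  let ?cell = "\<lambda>C i. {t \<in> space (M i). t \<in> A i \<longleftrightarrow> i \<in> C}"
  interpret P: prob_space "Pi\<^sub>M I M" using prob by (rule prob_space_PiM)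
  have cell: "?cell C i \<in> sets (M i)" if "i \<in> I" for C i
    using A[OF that] by (rule pattern_cell_in_sets)
  have box: "Pi\<^sub>E I (?cell C) \<in> sets (Pi\<^sub>M I M)" for C
    using fin cell by (intro sets_PiM_I_finite) auto
  have "disjoint_family_on (\<lambda>C. Pi\<^sub>E I (?cell C)) {C \<in> Pow I. Q C}"
    unfolding disjoint_family_on_def
    using in_pattern_cell_iff[where I = I and M = M and A = A] by blast
  then have "P.prob {w \<in> space (Pi\<^sub>M I M). Q {i \<in> I. w i \<in> A i}} =
      (\<Sum>C\<in>{C \<in> Pow I. Q C}. P.prob (Pi\<^sub>E I (?cell C)))"
    unfolding pattern_event_eq using fin box
    by (intro P.finite_measure_finite_Union) auto
  also have "\<dots> = (\<Sum>C | C \<subseteq> I \<and> Q C. \<Prod>i\<in>I.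
      if i \<in> C then measure (M i) (A i) else 1 - measure (M i) (A i))"
  proof (rule sum.cong)
    fix C
    \<comment> \<open>With all of \<open>I\<close> as the base of the cylinder, the embedding is the
      identity on boxes.\<close>
    have "emeasure (Pi\<^sub>M I M) (Pi\<^sub>E I (?cell C)) = (\<Prod>i\<in>I. emeasure (M i) (?cell C i))"
      using emeasure_PiM_emb[OF prob order_refl fin cell] by simp
    also have "\<dots> = (\<Prod>i\<in>I. ennreal (measure (M i) (?cell C i)))"
      by (intro prod.cong refl finite_measure.emeasure_eq_measure prob_space.finite_measure prob)
    finally have "P.prob (Pi\<^sub>E I (?cell C)) = (\<Prod>i\<in>I. measure (M i) (?cell C i))"
      by (simp add: measure_def prod_ennreal prod_nonneg)
    also have "\<dots> = (\<Prod>i\<in>I. if i \<in> C then measure (M i) (A i) else 1 - measure (M i) (A i))"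
    proof (rule prod.cong[OF refl])
      fix i assume i: "i \<in> I"
      have "?cell C i = (if i \<in> C then A i else space (M i) - A i)"
        using sets.sets_into_space[OF A[OF i]] by auto
      then show "measure (M i) (?cell C i) =
          (if i \<in> C then measure (M i) (A i) else 1 - measure (M i) (A i))"
        using prob_space.prob_compl[OF prob[OF i] A[OF i]] by simp
    qed
    finally show "P.prob (Pi\<^sub>E I (?cell C)) = \<dots>" .
  qed auto
  finally show ?thesis .
qed

text \<open>The underlying space is the whole real line, so the half-lines \<open>{..p}\<close> are
  measurable as they stand.\<close>

abbreviation uniform_\<Y> :: "real measure" where
  "uniform_\<Y> \<equiv> uniform_measure lborel \<Y>"

lemma prob_space_uniform_\<Y>: "prob_space uniform_\<Y>"
  by (rule prob_space_uniform_measure) auto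

lemma measure_uniform_\<Y>_atMost:
  assumes "p \<in> {0..1}"
  shows "measure uniform_\<Y> {..p} = p"
proof -
  have "\<Y> \<inter> {..p} = {0..p}" using assms by auto
  then show ?thesis using assms by (simp add: measure_uniform_measure)
qed

lemma counting_function_mono:
  fixes \<kappa> :: "(nat \<Rightarrow> nat) \<Rightarrow> nat"
  assumes count: "\<And>y ys. y \<in> \<Y> \<Longrightarrow> ys \<in> I \<rightarrow>\<^sub>E \<Y> \<Longrightarrow>
      of_bool (f ys \<le> y) = \<kappa> (\<lambda>i\<in>I. of_bool (ys i \<le> y))"
    and "C \<subseteq> D"
  shows "\<kappa> (\<lambda>i\<in>I. of_bool (i \<in> C)) \<le> \<kappa> (\<lambda>i\<in>I. of_bool (i \<in> D))"
proof -
  \<comment> \<open>Three levels suffice: the threshold 1/4 selects exactly \<open>C\<close>, the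
    threshold 3/4 selects \<open>C \<union> D = D\<close>, and the value 1 outside stays above both.
    The claim becomes that \<open>f ys \<le> 1/4\<close> implies
    \<open>f ys \<le> 3/4\<close>.\<close>
  define ys :: "nat \<Rightarrow> real" where
    "ys = (\<lambda>i\<in>I. if i \<in> C then 0 else if i \<in> D then 1/2 else 1)"
  have ys: "ys \<in> I \<rightarrow>\<^sub>E \<Y>" by (auto simp: ys_def)
  have "(\<lambda>i\<in>I. of_bool (ys i \<le> 1/4)) = (\<lambda>i\<in>I. of_bool (i \<in> C) :: nat)"
    by (auto simp: ys_def)
  then have C: "\<kappa> (\<lambda>i\<in>I. of_bool (i \<in> C)) = of_bool (f ys \<le> 1/4)"
    using count[of "1/4" ys] ys by simp
  have "(\<lambda>i\<in>I. of_bool (ys i \<le> 3/4)) = (\<lambda>i\<in>I. of_bool (i \<in> D) :: nat)"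
    using \<open>C \<subseteq> D\<close> by (auto simp: ys_def fun_eq_iff)
  then have "\<kappa> (\<lambda>i\<in>I. of_bool (i \<in> D)) = of_bool (f ys \<le> 3/4)"
    using count[of "3/4" ys] ys by simp
  with C show ?thesis by auto
qed

theorem proposition3:
  fixes X :: "'c set" and n :: nat and x :: "nat \<Rightarrow> 'c"
    and \<pi> :: "(nat \<Rightarrow> 'c) \<Rightarrow> (nat \<Rightarrow> real) \<Rightarrow> real"
  assumes "n \<ge> 1"
    and "x \<in> {0..n} \<rightarrow>\<^sub>E X"
    and "policy X n \<pi>"
    and "counting_policy n x \<pi>"
  shows "nondecreasing_separable_policy n x \<pi>"
proof -
  define I where "I = {1..n}"
  have fin: "finite I" by (simp add: I_def)
  have range: "\<pi> x ys \<in> \<Y>" if "ys \<in> I \<rightarrow>\<^sub>E \<Y>" for ys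
    using assms(2,3) that unfolding policy_def I_def by blast
  obtain \<kappa> :: "(nat \<Rightarrow> nat) \<Rightarrow> nat" where
    "\<forall>y\<in>\<Y>. \<forall>ys\<in>I \<rightarrow>\<^sub>E \<Y>. of_bool (\<pi> x ys \<le> y) = \<kappa> (\<lambda>i\<in>I. of_bool (ys i \<le> y))"
    using assms(4) unfolding counting_policy_def I_def by (elim exE conjE)
  then have \<kappa>: "of_bool (\<pi> x ys \<le> y) = \<kappa> (\<lambda>i\<in>I. of_bool (ys i \<le> y))"
    if "y \<in> \<Y>" "ys \<in> I \<rightarrow>\<^sub>E \<Y>" for y ys
    using that by simp
  \<comment> \<open>\<open>Q\<close> replaces 0-1 vectors by the sets of indices they mark. Stated
    with \<open>\<ge> 1\<close>, its monotonicity is transitivity of the order.\<close>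
  define Q where "Q C \<longleftrightarrow> \<kappa> (\<lambda>i\<in>I. of_bool (i \<in> C)) \<ge> 1" for C
  have Q_mono: "Q D" if "Q C" "C \<subseteq> D" for C D
    using counting_function_mono[where \<kappa> = \<kappa> and I = I and f = "\<pi> x", OF \<kappa> that(2)] that(1)
    by (simp add: Q_def)
  have \<pi>_iff: "\<pi> x ys \<le> y \<longleftrightarrow> Q {i \<in> I. ys i \<le> y}" if "y \<in> \<Y>" "ys \<in> I \<rightarrow>\<^sub>E \<Y>" for y ys
  proof -
    have "(\<lambda>i\<in>I. of_bool (i \<in> {i \<in> I. ys i \<le> y})) = (\<lambda>i\<in>I. of_bool (ys i \<le> y) :: nat)"
      by auto
    then show ?thesis
      unfolding Q_def using \<kappa>[OF that, symmetric] by simp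
  qed

  define U where "U = Pi\<^sub>M I (\<lambda>_. uniform_\<Y>)"
  interpret U: prob_space U
    unfolding U_def by (intro prob_space_PiM prob_space_uniform_\<Y>)
  define P where "P p = U.prob {u \<in> space U. Q {i \<in> I. u i \<in> {..p i}}}" for p :: "nat \<Rightarrow> real"
  have P_event: "{u \<in> space U. Q {i \<in> I. u i \<in> {..p i}}} \<in> U.events" for p :: "nat \<Rightarrow> real"
    unfolding U_def by (rule pattern_event_in_sets[OF fin]) simp

  \<comment> \<open>Measurability of the policy is derived rather than assumed: each sublevel set is
    a pattern event.\<close>
  have "\<pi> x \<in> borel_measurable (Pi\<^sub>M I (\<lambda>_. borel_\<Y>))"
    unfolding borel_measurable_iff_le
  proof
    let ?B = "Pi\<^sub>M I (\<lambda>_. borel_\<Y>)"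
    have sp: "space ?B = I \<rightarrow>\<^sub>E \<Y>" by (simp add: space_PiM space_restrict_space)
    have bounds: "0 \<le> \<pi> x ys" "\<pi> x ys \<le> 1" if "ys \<in> space ?B" for ys
      using range[of ys] that by (simp_all add: sp)
    fix a :: real
    \<comment> \<open>The counting identity speaks only of thresholds in \<open>\<Y>\<close>;
      outside, the range of the policy makes the sublevel set empty or everything.\<close>
    consider "a < 0" | "a \<in> \<Y>" | "a > 1" unfolding atLeastAtMost_iff by linarith
    then show "{ys \<in> space ?B. \<pi> x ys \<le> a} \<in> sets ?B"
    proof cases
      case 1
      then have "{ys \<in> space ?B. \<pi> x ys \<le> a} = {}"
        using bounds(1) by (auto simp: not_le intro: less_le_trans)
      then show ?thesis by (simp only: sets.empty_sets)
    next
      case 2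
      \<comment> \<open>\<open>{0..a}\<close> stands in for \<open>{..a}\<close>, which is not a
        subset of \<open>\<Y>\<close> and hence not measurable in \<open>borel_\<Y>\<close>.\<close>
      then have "{ys \<in> space ?B. \<pi> x ys \<le> a} =
          {ys \<in> space ?B. Q {i \<in> I. ys i \<in> {0..a}}}"
      proof (intro Collect_cong conj_cong refl)
        fix ys assume "ys \<in> space ?B"
        then have "ys \<in> I \<rightarrow>\<^sub>E \<Y>" and "{i \<in> I. ys i \<in> {0..a}} = {i \<in> I. ys i \<le> a}"
          by (auto simp: sp PiE_iff)
        then show "\<pi> x ys \<le> a \<longleftrightarrow> Q {i \<in> I. ys i \<in> {0..a}}" using \<pi>_iff[OF 2] by simp
      qed
      also have "\<dots> \<in> sets ?B"
        by (rule pattern_event_in_sets[OF fin]) (use 2 in \<open>simp add: sets_restrict_space_iff\<close>)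
      finally show ?thesis .
    next
      case 3
      then have "{ys \<in> space ?B. \<pi> x ys \<le> a} = space ?B"
        using bounds(2) by (auto intro: order_trans less_imp_le)
      then show ?thesis by (simp only: sets.top)
    qed
  qed
  then have meas: "\<pi> x \<in> Pi\<^sub>M I (\<lambda>_. borel_\<Y>) \<rightarrow>\<^sub>M borel_\<Y>"
    using range by (intro measurable_restrict_space2)
      (auto simp: space_PiM space_restrict_space)

  have law: "measure (Pi\<^sub>M I F) {ys \<in> space (Pi\<^sub>M I F). \<pi> x ys \<le> y}
      = P (\<lambda>i\<in>I. cdf_on_\<Y> (F i) y)"
    if F: "F \<in> I \<rightarrow> distributions_on_\<Y>" and y: "y \<in> \<Y>" for F y
  proof -
    define A where "A i = {t \<in> space (F i). t \<le> y}" for i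
    define p where "p = (\<lambda>i\<in>I. cdf_on_\<Y> (F i) y)"
    have prob: "prob_space (F i)" and sets: "sets (F i) = sets borel_\<Y>" if "i \<in> I" for i
      using F that by (auto simp: distributions_on_\<Y>_def)
    have sp: "space (F i) = \<Y>" if "i \<in> I" for i
      using sets_eq_imp_space_eq[OF sets[OF that]] by (simp add: space_restrict_space)
    have A: "A i \<in> sets (F i)" if "i \<in> I" for i
      using that by (auto simp: A_def sp sets sets_restrict_space_iff)
    have p: "measure (F i) (A i) = p i" "p i \<in> {0..1}" if "i \<in> I" for i
      using that prob[OF that] by (auto simp: p_def cdf_on_\<Y>_def A_def prob_space.prob_le_1)
    have "{ys \<in> space (Pi\<^sub>M I F). \<pi> x ys \<le> y} =
        {ys \<in> space (Pi\<^sub>M I F). Q {i \<in> I. ys i \<in> A i}}"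
    proof (rule Collect_cong, rule conj_cong[OF refl])
      fix ys assume ys: "ys \<in> space (Pi\<^sub>M I F)"
      then have "ys \<in> I \<rightarrow>\<^sub>E \<Y>" and "{i \<in> I. ys i \<in> A i} = {i \<in> I. ys i \<le> y}"
        using sp by (auto simp: space_PiM PiE_iff A_def)
      then show "\<pi> x ys \<le> y \<longleftrightarrow> Q {i \<in> I. ys i \<in> A i}" using \<pi>_iff[OF y] by simp
    qed
    then have "measure (Pi\<^sub>M I F) {ys \<in> space (Pi\<^sub>M I F). \<pi> x ys \<le> y} =
        (\<Sum>C | C \<subseteq> I \<and> Q C. \<Prod>i\<in>I.
          if i \<in> C then measure (F i) (A i) else 1 - measure (F i) (A i))"
      using measure_pattern_event[where I = I and M = F and A = A and Q = Q] fin prob A by simp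
    \<comment> \<open>Each \<open>p i\<close> is a cdf value in the unit interval, hence also the
      uniform probability of \<open>{..p i}\<close>; the sum is now that of a pattern event on
      \<open>U\<close>.\<close>
    also have "\<dots> = (\<Sum>C | C \<subseteq> I \<and> Q C. \<Prod>i\<in>I.
        if i \<in> C then measure uniform_\<Y> {..p i} else 1 - measure uniform_\<Y> {..p i})"
      by (intro sum.cong prod.cong refl) (simp only: p measure_uniform_\<Y>_atMost)
    also have "\<dots> = P p"
      unfolding P_def U_def
      by (rule measure_pattern_event[OF fin prob_space_uniform_\<Y>, symmetric]) simp
    finally show ?thesis unfolding p_def .
  qed

  have "separable_via n x \<pi> P"
    unfolding separable_via_def I_def[symmetric] using meas law by (auto simp: P_def)
  moreover have "coordinatewise_nondecreasing n P"
    unfolding coordinatewise_nondecreasing_def P_def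
    \<comment> \<open>The measure on \<open>U\<close> does not depend on \<open>p\<close>. Raising
      one \<open>p i\<close> enlarges the pattern of every point, so by \<open>Q_mono\<close> the
      event grows.\<close>
    by (intro ballI mono_onI U.finite_measure_mono P_event) (auto elim!: Q_mono)
  ultimately show ?thesis
    unfolding nondecreasing_separable_policy_def by blast
qed

end
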